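(* Let $\mathcal{C}$ be a complex vector subspace of $\mathcal{M}$ which is maximal in $\mathcal{C}_v$, and let $\widehat{\mathrm{st}}_{\mathcal{C}}:\mathcal{F}_v\to\mathcal{F}_v$ be the pseudostandard part mapping determined by $\mathcal{C}$. Then: (i) $\widehat{\mathrm{st}}_{\mathcal{C}}$ is a linear homomorphism from $\mathcal{F}_v$ into $\mathcal{F}_v$ with range $\mathcal{C}$; i.e. $\widehat{\mathrm{st}}_{\mathcal{C}}(\alpha f+\beta g)=\alpha\,\widehat{\mathrm{st}}_{\mathcal{C}}(f)+\beta\,\widehat{\mathrm{st}}_{\mathcal{C}}(g)$ for all $f,g\in\mathcal{F}_v$ and all $\alpha,\beta\in\mathbb{C}$. (ii) $\mathcal{C}$ consists of the fixed points of $\widehat{\mathrm{st}}_{\mathcal{C}}$ in $\mathcal{F}_v$, i.e. $\mathcal{C}=\{f\in\mathcal{F}_v : \widehat{\mathrm{st}}_{\mathcal{C}}(f)=f\}$. Consequently, $\widehat{\mathrm{st}}_{\mathcal{C}}\circ\widehat{\mathrm{st}}_{\mathcal{C}}=\widehat{\mathrm{st}}_{\mathcal{C}}$. (iii) Suppose in addition that $\Phi\subset\mathcal{C}$ for some linearly $v$-independent subset $\Phi$ of $\mathcal{M}$. Then $\widehat{\mathrm{st}}_{\mathcal{C}}(\varphi+d\varphi)=\varphi$ for all $\varphi\in\mathrm{Span}_{\mathbb{C}}(\Phi)$ and all $d\varphi\in\mathcal{I}_v$. Consequently, $\widehat{\mathrm{st}}_{\mathcal{C}}(c+d\varphi)=c$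 for all $c\in\mathbb{C}$ and all $d\varphi\in\mathcal{I}_v$; equivalently, for every $f\in\mathbb{C}\oplus\mathcal{I}_v$ one has $\widehat{\mathrm{st}}_{\mathcal{C}}(f)=\lim_{x\to\infty}f(x)$.
   Context: $G_\infty(\mathbb{R},\mathbb{C})$ is the ring (pointwise operations) of germs at $+\infty$ of complex valued functions defined on a subset of $\mathbb{R}$ containing some $(n,\infty)$, $n\in\mathbb{N}$. $\mathcal{M}=\{f\in G_\infty(\mathbb{R},\mathbb{C}): f(x)=O(x^n)\text{ as }x\to\infty\text{ for some }n\in\mathbb{N}\}$. For $f\in\mathcal{M}$, $v(f)=\sup\{r\in\mathbb{R}: f(x)=O(1/x^r)\text{ as }x\to\infty\}\in\mathbb{R}\cup\{\infty\}$. $\mathcal{I}_v$, $\mathcal{F}_v$, $\mathcal{C}_v$ are the sets of $f\in\mathcal{M}$ with $v(f)>0$, $v(f)\ge0$, $v(f)=0$, respectively. A complex vector subspace $\mathcal{C}$ of $\mathcal{M}$ is maximal in $\mathcal{C}_v$ if $\mathbb{C}\subset\mathcal{C}\subset\mathcal{C}_v\cup\{0\}$ (with $\mathbb{C}$ the constant functions) and there is no vector subspace $\mathcal{K}$ of $\mathcal{M}$ with $\mathcal{C}\subsetneqq\mathcal{K}\subset\mathcal{C}_v\cup\{0\}$. For such $\mathcal{C}$ every $f\in\mathcal{F}_v$ can be written uniquely as $f=\varphi+d\varphi$ with $\varphi\in\mathcal{C}$, $d\varphi\in\mathcal{I}_v$, and the pseudostandard part mapping is defined by $\widehat{\mathrm{st}}_{\mathcal{C}}(\varphi+d\varphi)=\varphi$.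 A set $\Phi\subset\mathcal{M}$ is linearly $v$-independent over $\mathbb{C}$ if $\mathrm{Span}_{\mathbb{C}}(\Phi)\subset\mathcal{C}_v\cup\{0\}$. *)

theory Defs
  imports
    "HOL-Library.Extended_Real"
    "HOL-Library.Landau_Symbols"
begin

section \<open>Germs at infinity\<close>

text \<open>
  A function defined only on a set containing some \<open>(n, \<infinity>)\<close> has the same germ as any
  extension of it to all of the real line, so total functions suffice as representatives.
\<close>

quotient_type germ = "real \<Rightarrow> complex" / "\<lambda>f g. eventually (\<lambda>x. f x = g x) at_top"
proof (rule equivpI)
  show "reflp (\<lambda>f g :: real \<Rightarrow> complex. eventually (\<lambda>x. f x = g x) at_top)"
    by (simp add: reflp_def)
  show "symp (\<lambda>f g :: real \<Rightarrow> complex. eventually (\<lambda>x. f x = g x) at_top)"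
    by (auto simp: symp_def elim: eventually_mono)
  show "transp (\<lambda>f g :: real \<Rightarrow> complex. eventually (\<lambda>x. f x = g x) at_top)"
    unfolding transp_def by (intro allI impI) (erule (1) eventually_elim2, simp)
qed

instantiation germ :: comm_ring_1
begin

lift_definition zero_germ :: germ is "\<lambda>_. 0" .

lift_definition one_germ :: germ is "\<lambda>_. 1" .

lift_definition plus_germ :: "germ \<Rightarrow> germ \<Rightarrow> germ" is "\<lambda>f g x. f x + g x"
  by (erule (1) eventually_elim2, simp)

lift_definition minus_germ :: "germ \<Rightarrow> germ \<Rightarrow> germ" is "\<lambda>f g x. f x - g x"
  by (erule (1) eventually_elim2, simp)

lift_definition uminus_germ :: "germ \<Rightarrow> germ" is "\<lambda>f x. - f x"
  by (erule eventually_mono, simp)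

lift_definition times_germ :: "germ \<Rightarrow> germ \<Rightarrow> germ" is "\<lambda>f g x. f x * g x"
  by (erule (1) eventually_elim2, simp)

instance
  by standard (transfer; simp add: algebra_simps)+

end

lift_definition germ_const :: "complex \<Rightarrow> germ" is "\<lambda>c _. c" .

lift_definition germ_scale :: "complex \<Rightarrow> germ \<Rightarrow> germ" is "\<lambda>c f x. c * f x"
  by (erule eventually_mono, simp)

global_interpretation germ: vector_space germ_scale
  by unfold_locales (transfer; simp add: algebra_simps)+

lift_definition germ_bigo :: "germ \<Rightarrow> (real \<Rightarrow> real) \<Rightarrow> bool"
  is "\<lambda>f g. f \<in> O[at_top](\<lambda>x. complex_of_real (g x))"
  by (intro ext landau_o.big.in_cong)

lift_definition germ_tendsto :: "germ \<Rightarrow> complex \<Rightarrow> bool"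
  is "\<lambda>f l. (f \<longlongrightarrow> l) at_top"
  by (intro ext tendsto_cong)


section \<open>Moderate germs and the valuation\<close>

definition moderate :: "germ set"
  where "moderate = {f. \<exists>n::nat. germ_bigo f (\<lambda>x. x ^ n)}"

text \<open>The valuation is only meaningful on moderate germs, where it is never \<open>-\<infinity>\<close>.\<close>

definition val :: "germ \<Rightarrow> ereal"
  where "val f = Sup {ereal r |r. germ_bigo f (\<lambda>x. 1 / x powr r)}"

definition Iv :: "germ set"
  where "Iv = {f \<in> moderate. val f > 0}"

definition Fv :: "germ set"
  where "Fv = {f \<in> moderate. val f \<ge> 0}"

definition Cv :: "germ set"
  where "Cv = {f \<in> moderate. val f = 0}"

definition v_independent :: "germ set \<Rightarrow> bool"
  where "v_independent \<Phi> \<longleftrightarrow> \<Phi> \<subseteq> moderate \<and> germ.span \<Phi> \<subseteq> Cv \<union> {0}"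

definition maximal_in_Cv :: "germ set \<Rightarrow> bool"
  where "maximal_in_Cv C \<longleftrightarrow>
    germ.subspace C \<and> C \<subseteq> moderate \<and>
    range germ_const \<subseteq> C \<and> C \<subseteq> Cv \<union> {0} \<and>
    \<not> (\<exists>K. germ.subspace K \<and> K \<subseteq> moderate \<and> C \<subset> K \<and> K \<subseteq> Cv \<union> {0})"

definition pst :: "germ set \<Rightarrow> germ \<Rightarrow> germ"
  where "pst C f = (THE \<phi>. \<phi> \<in> C \<and> (\<exists>d\<phi>\<in>Iv. f = \<phi> + d\<phi>))"


section \<open>Well-definedness of the pseudostandard part\<close>

lemma germ_bigo_mono:
  assumes "germ_bigo f (\<lambda>x. 1 / x powr r)" "s \<le> r"
  shows "germ_bigo f (\<lambda>x. 1 / x powr s)"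
  using assms
proof transfer
  fix f :: "real \<Rightarrow> complex" and r s :: real
  assume f: "f \<in> O(\<lambda>x. complex_of_real (1 / x powr r))" and "s \<le> r"
  have "(\<lambda>x. complex_of_real (1 / x powr r)) \<in> O(\<lambda>x. complex_of_real (1 / x powr s))"
  proof (rule landau_o.big_mono)
    show "\<forall>\<^sub>F x in at_top. norm (complex_of_real (1 / x powr r)) \<le> norm (complex_of_real (1 / x powr s))"
      using eventually_ge_at_top[of "1::real"]
      by eventually_elim
        (use \<open>s \<le> r\<close> in \<open>auto simp: norm_divide divide_simps intro!: powr_mono\<close>)
  qed
  with f show "f \<in> O(\<lambda>x. complex_of_real (1 / x powr s))"
    by (rule landau_o.big_trans)
qed

lemma germ_bigo_add: "germ_bigo f h \<Longrightarrow> germ_bigo g h \<Longrightarrow> germ_bigo (f + g) h"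
  by transfer (rule sum_in_bigo)

lemma germ_bigo_scale: "germ_bigo f h \<Longrightarrow> germ_bigo (germ_scale c f) h"
  by transfer simp

lemma germ_bigo_zero: "germ_bigo 0 h"
  by transfer simp

lemma less_val_imp_bigo: "ereal s < val f \<Longrightarrow> germ_bigo f (\<lambda>x. 1 / x powr s)"
  unfolding val_def less_Sup_iff using germ_bigo_mono by fastforce

lemma bigo_imp_le_val: "germ_bigo f (\<lambda>x. 1 / x powr s) \<Longrightarrow> ereal s \<le> val f"
  unfolding val_def by (rule Sup_upper) blast

lemma bigo_imp_moderate:
  assumes "germ_bigo f (\<lambda>x. 1 / x powr s)"
  shows "f \<in> moderate"
proof -
  obtain n :: nat where n: "- s \<le> real n"
    using real_arch_simple by blast
  have "germ_bigo f (\<lambda>x. 1 / x powr (- real n))"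
    using assms n by (intro germ_bigo_mono[OF assms]) simp
  then have "germ_bigo f (\<lambda>x. x ^ n)"
  proof transfer
    fix f :: "real \<Rightarrow> complex" and n :: nat
    assume f: "f \<in> O(\<lambda>x. complex_of_real (1 / x powr (- real n)))"
    have "\<forall>\<^sub>F x in at_top. complex_of_real (1 / x powr (- real n)) = complex_of_real (x ^ n)"
      using eventually_gt_at_top[of "0::real"]
      by eventually_elim (simp add: powr_minus powr_realpow divide_simps)
    with f show "f \<in> O(\<lambda>x. complex_of_real (x ^ n))"
      by (simp add: landau_o.big.cong)
  qed
  then show ?thesis
    by (auto simp: moderate_def)
qed

lemma Iv_iff: "f \<in> Iv \<longleftrightarrow> (\<exists>s>0. germ_bigo f (\<lambda>x. 1 / x powr s))"
proof
  assume "f \<in> Iv"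
  then have "0 < val f"
    by (simp add: Iv_def)
  then obtain s where "0 < ereal s" "ereal s < val f"
    using ereal_dense2 by blast
  then show "\<exists>s>0. germ_bigo f (\<lambda>x. 1 / x powr s)"
    by (intro exI[of _ s]) (simp add: less_val_imp_bigo)
next
  assume "\<exists>s>0. germ_bigo f (\<lambda>x. 1 / x powr s)"
  then obtain s where s: "s > 0" "germ_bigo f (\<lambda>x. 1 / x powr s)"
    by blast
  have "0 < ereal s" using s by simp
  also have "\<dots> \<le> val f" using s(2) by (rule bigo_imp_le_val)
  finally show "f \<in> Iv"
    using s(2) bigo_imp_moderate by (simp add: Iv_def)
qed

lemma Fv_iff: "f \<in> Fv \<longleftrightarrow> (\<forall>s<0. germ_bigo f (\<lambda>x. 1 / x powr s))"
proof
  assume "f \<in> Fv"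
  then have "0 \<le> val f"
    by (simp add: Fv_def)
  moreover have "ereal s < 0" if "s < 0" for s using that by simp
  ultimately show "\<forall>s<0. germ_bigo f (\<lambda>x. 1 / x powr s)"
    by (intro allI impI less_val_imp_bigo) (meson less_le_trans)
next
  assume *: "\<forall>s<0. germ_bigo f (\<lambda>x. 1 / x powr s)"
  have "0 \<le> val f"
  proof (rule ccontr)
    assume "\<not> 0 \<le> val f"
    then obtain s where s: "val f < ereal s" "ereal s < 0"
      using ereal_dense2[of "val f" 0] by (meson not_le)
    with * have "ereal s \<le> val f"
      by (intro bigo_imp_le_val) simp
    with s show False by simp
  qed
  moreover have "f \<in> moderate"
    by (rule bigo_imp_moderate[of f "-1"], rule *[rule_format]) simp
  ultimately show "f \<in> Fv"
    by (simp add: Fv_def)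
qed

lemma subspace_Fv: "germ.subspace Fv"
  by (rule germ.subspaceI) (auto simp: Fv_iff germ_bigo_zero germ_bigo_add germ_bigo_scale)

lemma subspace_Iv: "germ.subspace Iv"
proof (rule germ.subspaceI)
  show "0 \<in> Iv"
    by (auto simp: Iv_iff germ_bigo_zero intro: exI[of _ 1])
  show "germ_scale c f \<in> Iv" if "f \<in> Iv" for c f
    using that by (auto simp: Iv_iff germ_bigo_scale)
  show "f + g \<in> Iv" if "f \<in> Iv" "g \<in> Iv" for f g
  proof -
    obtain s t where "s > 0" "germ_bigo f (\<lambda>x. 1 / x powr s)"
      "t > 0" "germ_bigo g (\<lambda>x. 1 / x powr t)"
      using \<open>f \<in> Iv\<close> \<open>g \<in> Iv\<close> by (auto simp: Iv_iff)
    then have "min s t > 0" "germ_bigo (f + g) (\<lambda>x. 1 / x powr (min s t))"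
      by (auto intro!: germ_bigo_add intro: germ_bigo_mono)
    then show ?thesis
      unfolding Iv_iff by blast
  qed
qed

lemma Cv_eq: "Cv = Fv - Iv"
  by (auto simp: Cv_def Fv_def Iv_def)

lemma pst_decomposition:
  assumes C: "maximal_in_Cv C" and f: "f \<in> Fv"
  shows "\<exists>!\<phi>. \<phi> \<in> C \<and> (\<exists>d\<phi>\<in>Iv. f = \<phi> + d\<phi>)"
proof (rule ex_ex1I)
  have sub: "germ.subspace C" and CCv: "C \<subseteq> Cv \<union> {0}"
    using C by (auto simp: maximal_in_Cv_def)
  have CFv: "C \<subseteq> Fv"
    using CCv germ.subspace_0[OF subspace_Fv] by (auto simp: Cv_eq)
  show "\<exists>\<phi>. \<phi> \<in> C \<and> (\<exists>d\<phi>\<in>Iv. f = \<phi> + d\<phi>)"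
  proof (rule ccontr)
    assume no: "\<not> ?thesis"
    define K where "K = germ.span (insert f C)"
    have "f \<in> K" "C \<subseteq> K"
      by (auto simp: K_def germ.span_base)
    moreover have "f \<notin> C"
      using no germ.subspace_0[OF subspace_Iv] by force
    ultimately have "C \<subset> K"
      by blast
    moreover have "K \<subseteq> Cv \<union> {0}"
    proof
      fix k assume "k \<in> K"
      then obtain a where a: "k - germ_scale a f \<in> C"
        using germ.span_eq_iff[THEN iffD2, OF sub] by (auto simp: K_def germ.span_insert)
      have "germ_scale a f \<in> Fv"
        by (rule germ.subspace_scale[OF subspace_Fv f])
      with a CFv have "(k - germ_scale a f) + germ_scale a f \<in> Fv"
        by (intro germ.subspace_add[OF subspace_Fv]) auto
      then have kF: "k \<in> Fv"
        by simp
      show "k \<in> Cv \<union> {0}"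
      proof (cases "a = 0")
        case True
        then show ?thesis
          using a CCv by auto
      next
        case False
        have "k \<notin> Iv"
        proof
          assume "k \<in> Iv"
          define \<phi> where "\<phi> = germ_scale (- inverse a) (k - germ_scale a f)"
          have "\<phi> \<in> C"
            unfolding \<phi>_def by (rule germ.subspace_scale[OF sub a])
          moreover have "germ_scale (inverse a) k \<in> Iv"
            by (rule germ.subspace_scale[OF subspace_Iv \<open>k \<in> Iv\<close>])
          moreover have "f = \<phi> + germ_scale (inverse a) k"
            using False by (simp add: \<phi>_def germ.scale_right_diff_distrib)
          ultimately show False
            using no by blast
        qed
        with kF show ?thesis
          by (simp add: Cv_eq)
      qed
    qed
    moreover have "germ.subspace K"
      by (simp add: K_def)
    moreover have "K \<subseteq> moderate"
    proof -
      have "insert f C \<subseteq> Fv"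
        using f CFv by simp
      then have "K \<subseteq> Fv"
        unfolding K_def by (rule germ.span_minimal) (rule subspace_Fv)
      then show ?thesis
        by (auto simp: Fv_def)
    qed
    ultimately show False
      using C by (auto simp: maximal_in_Cv_def)
  qed
  show "\<phi> = \<psi>"
    if "\<phi> \<in> C \<and> (\<exists>d\<phi>\<in>Iv. f = \<phi> + d\<phi>)" "\<psi> \<in> C \<and> (\<exists>d\<phi>\<in>Iv. f = \<psi> + d\<phi>)" for \<phi> \<psi>
  proof -
    obtain d e where de: "d \<in> Iv" "e \<in> Iv" "f = \<phi> + d" "f = \<psi> + e"
      using \<open>\<phi> \<in> C \<and> _\<close> \<open>\<psi> \<in> C \<and> _\<close> by blast
    have "\<phi> - \<psi> = e - d"
      using de by (simp add: algebra_simps)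
    moreover have "e - d \<in> Iv"
      using de by (intro germ.subspace_diff[OF subspace_Iv])
    moreover have "\<phi> - \<psi> \<in> C"
      using that by (intro germ.subspace_diff[OF sub]) auto
    ultimately have "\<phi> - \<psi> = 0"
      using CCv by (auto simp: Cv_eq)
    then show ?thesis
      by simp
  qed
qed

end

theory Submission
  imports Defs
begin

text \<open>Maximality of \<open>C\<close> makes \<open>Fv\<close> the direct sum of the subspaces
  \<open>C\<close> and \<open>Iv\<close>; this is \<open>pst_decomposition\<close>. Hence
  \<open>pst C\<close> is the projection onto \<open>C\<close> along \<open>Iv\<close>, and
  linearity, the range, the fixed points and idempotence are general facts about projections. The
  lemma \<open>pst_eqI\<close> carries all of this: any decomposition that can be exhibited gives
  the value of \<open>pst C\<close>. For the limit formula, a germ in \<open>Iv\<close> is bounded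
  by a negative power of x, so it tends to 0 and only the constant part survives.\<close>

lemma Iv_subset_Fv: "Iv \<subseteq> Fv"
  by (auto simp: Iv_def Fv_def)

lemma maximal_in_Cv_subset_Fv:
  assumes "maximal_in_Cv C"
  shows "C \<subseteq> Fv"
  using assms germ.subspace_0[OF subspace_Fv] by (auto simp: maximal_in_Cv_def Cv_eq)

text \<open>Uniqueness of the decomposition lets the description operator in \<open>pst\<close> be
  evaluated; later proofs need only exhibit a splitting.\<close>

lemma pst_eqI:
  assumes "maximal_in_Cv C" "\<phi> \<in> C" "d\<phi> \<in> Iv"
  shows "pst C (\<phi> + d\<phi>) = \<phi>"
proof -
  have "\<phi> + d\<phi> \<in> Fv"
    using assms maximal_in_Cv_subset_Fv Iv_subset_Fv
    by (intro germ.subspace_add[OF subspace_Fv]) auto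
  from pst_decomposition[OF assms(1) this] show ?thesis
    unfolding pst_def by (rule the1_equality) (use assms in blast)
qed

text \<open>This is the splitting with remainder 0; it yields the fixed points, surjectivity onto
  \<open>C\<close> and idempotence.\<close>

lemma pst_id:
  assumes "maximal_in_Cv C" "\<phi> \<in> C"
  shows "pst C \<phi> = \<phi>"
  using pst_eqI[OF assms germ.subspace_0[OF subspace_Iv]] by simp

lemma pst_decompE:
  assumes "maximal_in_Cv C" "f \<in> Fv"
  obtains d\<phi> where "pst C f \<in> C" "d\<phi> \<in> Iv" "f = pst C f + d\<phi>"
  using theI'[OF pst_decomposition[OF assms]] that unfolding pst_def by blast

lemma pst_linear:
  assumes C: "maximal_in_Cv C" and f: "f \<in> Fv" and g: "g \<in> Fv"
  shows "pst C (germ_scale \<alpha> f + germ_scale \<beta> g) =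
    germ_scale \<alpha> (pst C f) + germ_scale \<beta> (pst C g)"
proof -
  have sub: "germ.subspace C"
    using C by (simp add: maximal_in_Cv_def)
  obtain d where d: "pst C f \<in> C" "d \<in> Iv" "f = pst C f + d"
    by (rule pst_decompE[OF C f])
  obtain e where e: "pst C g \<in> C" "e \<in> Iv" "g = pst C g + e"
    by (rule pst_decompE[OF C g])
  have "germ_scale \<alpha> f + germ_scale \<beta> g =
      germ_scale \<alpha> (pst C f + d) + germ_scale \<beta> (pst C g + e)"
    using d(3) e(3) by simp
  \<comment> \<open>Regrouping puts a member of \<open>C\<close> first and a member of
    \<open>Iv\<close> second, since both are subspaces; \<open>pst_eqI\<close> then reads off the
    value.\<close>
  also have "\<dots> = (germ_scale \<alpha> (pst C f) + germ_scale \<beta> (pst C g)) +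
      (germ_scale \<alpha> d + germ_scale \<beta> e)"
    by (simp add: germ.scale_right_distrib algebra_simps)
  finally show ?thesis
    using d(1,2) e(1,2)
    by (simp add: pst_eqI[OF C] germ.subspace_add[OF sub] germ.subspace_scale[OF sub]
        germ.subspace_add[OF subspace_Iv] germ.subspace_scale[OF subspace_Iv])
qed

text \<open>The positive exponent forces decay: a constant multiple of \<open>x powr (- s)\<close>
  eventually dominates the germ.\<close>

lemma germ_bigo_powr_tendsto_0:
  assumes "germ_bigo f (\<lambda>x. 1 / x powr s)" "s > 0"
  shows "germ_tendsto f 0"
  using assms
proof transfer
  fix f :: "real \<Rightarrow> complex" and s :: real
  assume f: "f \<in> O(\<lambda>x. complex_of_real (1 / x powr s))" and s: "s > 0"
  obtain c where c: "\<forall>\<^sub>F x in at_top. norm (f x) \<le> c * norm (complex_of_real (1 / x powr s))"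
    using f by (rule landau_o.bigE)
  have "((\<lambda>x. x powr (- s)) \<longlongrightarrow> 0) at_top"
    using s by (intro tendsto_neg_powr filterlim_ident) simp
  moreover have "\<forall>\<^sub>F x in at_top. norm (f x) \<le> norm (x powr (- s)) * c"
    using c by eventually_elim (simp add: norm_inverse powr_minus divide_inverse mult.commute)
  ultimately show "(f \<longlongrightarrow> 0) at_top"
    by (rule tendsto_0_le)
qed

lemma germ_tendsto_const_add: "germ_tendsto f l \<Longrightarrow> germ_tendsto (germ_const c + f) (c + l)"
  by transfer (intro tendsto_add tendsto_const)

lemma germ_tendsto_const_add_Iv:
  assumes "d \<in> Iv"
  shows "germ_tendsto (germ_const c + d) c"
  using assms germ_bigo_powr_tendsto_0 germ_tendsto_const_add[of d 0 c] by (auto simp: Iv_iff)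

theorem theorem6:
  fixes C :: "germ set"
  assumes "maximal_in_Cv C"
  shows
    "((\<forall>f\<in>Fv. pst C f \<in> Fv) \<and> pst C ` Fv = C \<and>
      (\<forall>f\<in>Fv. \<forall>g\<in>Fv. \<forall>\<alpha> \<beta>.
         germ_scale \<alpha> f + germ_scale \<beta> g \<in> Fv \<and>
         pst C (germ_scale \<alpha> f + germ_scale \<beta> g) =
         germ_scale \<alpha> (pst C f) + germ_scale \<beta> (pst C g))) \<and>
     (C = {f \<in> Fv. pst C f = f} \<and>
      (\<forall>f\<in>Fv. (pst C \<circ> pst C) f = pst C f)) \<and>
     ((\<forall>\<Phi>. v_independent \<Phi> \<and> \<Phi> \<subseteq> C \<longrightarrow>
        (\<forall>\<phi>\<in>germ.span \<Phi>. \<forall>d\<phi>\<in>Iv. pst C (\<phi> + d\<phi>) = \<phi>)) \<and>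
      (\<forall>c. \<forall>d\<phi>\<in>Iv. pst C (germ_const c + d\<phi>) = germ_const c) \<and>
      (\<forall>f\<in>{germ_const c + d\<phi> |c d\<phi>. d\<phi> \<in> Iv}.
         \<exists>l. germ_tendsto f l \<and> pst C f = germ_const l))"
proof -
  have sub: "germ.subspace C" and const: "\<And>c. germ_const c \<in> C"
    using assms by (auto simp: maximal_in_Cv_def)
  have CFv: "C \<subseteq> Fv"
    by (rule maximal_in_Cv_subset_Fv[OF assms])
  have inC: "pst C f \<in> C" if "f \<in> Fv" for f
    using pst_decompE[OF assms that] by blast
  \<comment> \<open>Each element of \<open>C\<close> lies in \<open>Fv\<close> and is its own
    preimage.\<close>
  have "pst C ` Fv = C"
    using inC CFv pst_id[OF assms] by force
  moreover have "germ_scale \<alpha> f + germ_scale \<beta> g \<in> Fv" if "f \<in> Fv" "g \<in> Fv" for f g \<alpha> \<beta>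
    using that by (intro germ.subspace_add germ.subspace_scale subspace_Fv)
  moreover have "C = {f \<in> Fv. pst C f = f}"
    using inC CFv pst_id[OF assms] by force
  \<comment> \<open>The subspace \<open>C\<close> contains the span of each of its subsets, so
    \<open>pst_eqI\<close> applies.\<close>
  moreover have "\<forall>\<Phi>. v_independent \<Phi> \<and> \<Phi> \<subseteq> C \<longrightarrow>
      (\<forall>\<phi>\<in>germ.span \<Phi>. \<forall>d\<phi>\<in>Iv. pst C (\<phi> + d\<phi>) = \<phi>)"
    using pst_eqI[OF assms] germ.span_minimal[OF _ sub] by blast
  moreover have "pst C (germ_const c + d\<phi>) = germ_const c" if "d\<phi> \<in> Iv" for c d\<phi>
    by (rule pst_eqI[OF assms const that])
  \<comment> \<open>The witness for \<open>l\<close> is the constant \<open>c\<close> of the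
    splitting, both the limit and the pseudostandard part.\<close>
  moreover have "\<forall>f\<in>{germ_const c + d\<phi> |c d\<phi>. d\<phi> \<in> Iv}.
      \<exists>l. germ_tendsto f l \<and> pst C f = germ_const l"
    using germ_tendsto_const_add_Iv pst_eqI[OF assms const] by blast
  ultimately show ?thesis
    using inC CFv pst_linear[OF assms] pst_id[OF assms]
    by (intro conjI) (simp_all add: subset_iff)
qed

end
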